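(* Let $q$ be a probability density on $\Theta$, let $r(\theta)=q(\theta)/\pi(\theta)$, and for $\epsilon\ge 0$ near $0$ consider the geometrically contaminated prior density $$\pi_\epsilon(\theta)=\frac{\pi^{1-\epsilon}(\theta)q^{\epsilon}(\theta)}{\int_\Theta\pi^{1-\epsilon}(\theta)q^{\epsilon}(\theta)\,d\theta}=\frac{r^\epsilon(\theta)\pi(\theta)}{E_\pi(r^\epsilon)}.$$ Let $RB_\epsilon(\theta\,|\,x)=f_{\theta,T}(T(x))/m_{\epsilon,T}(T(x))$ be the relative belief ratio at $\theta$ based on $\pi_\epsilon$. Then $$\left.\frac{\partial\log RB_\epsilon(\theta\,|\,x)}{\partial\epsilon}\right\vert_{\epsilon=0}=E_\pi(\log r)-E_{\pi(\cdot\,|\,x)}(\log r),$$ and this quantity satisfies $$E_{m_T}\left(\left.\frac{\partial\log RB_\epsilon(\theta\,|\,x)}{\partial\epsilon}\right\vert_{\epsilon=0}\right)=0,$$ where the expectation is taken with $T(x)$ distributed according to the density $m_T$.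
   Context: Setting: $T$ is a minimal sufficient statistic, with values in $\mathcal T$, for a statistical model with parameter space $\Theta$; $f_{\theta,T}$ is the sampling density of $T$ under $\theta$ with respect to a ($\sigma$-finite) support measure on $\mathcal T$. $\pi$ and $q$ are positive probability densities on $\Theta$ with respect to a common ($\sigma$-finite) support measure, denoted $d\theta$ (counting measure in the discrete case), with $\int_\Theta\pi^{1-\epsilon}q^\epsilon\,d\theta<\infty$. $m_T(t)=\int_\Theta f_{\theta,T}(t)\pi(\theta)\,d\theta$ is the prior predictive density of $T$ under $\pi$, and $m_{\epsilon,T}(t)=\int_\Theta f_{\theta,T}(t)\pi_\epsilon(\theta)\,d\theta$ that under $\pi_\epsilon$. $\pi(\cdot\,|\,x)$ is the posterior density under $\pi$, $\pi(\theta\,|\,x)=f_{\theta,T}(T(x))\pi(\theta)/m_T(T(x))$, which depends on $x$ only through $T(x)$; $E_\pi$ and $E_{\pi(\cdot\,|\,x)}$ denote prior and posterior expectations. For the $\theta$ under consideration, $f_{\theta,T}(t)>0$ and $0<m_T(t)<\infty$ for all $t\in\mathcal T$. The conditions of the dominated derivative theorem are assumed: there are $\epsilon_0>0$ and a function $g\geq 0$ on $\Theta$ with $|r^{\epsilon}\log r|\le g$ for all $\epsilon\in[0,\epsilon_0]$, $E_\pi(g)<\infty$, and $E_{\pi(\cdot\,|\,x)}(g)<\infty$ for every value $T(x)\in\mathcal T$. The derivative at $\epsilon=0$ is the right-hand derivative. *)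

theory Defs
  imports "HOL-Probability.Probability"
begin

text \<open>
  Throughout, the measure \<open>\<nu>\<close> on the parameter space and the measure \<open>\<mu>\<close> on the space of values of
  the statistic are the support measures with respect to which all densities are taken. The
  sampling density of the statistic under \<open>\<theta>\<close>, evaluated at \<open>t\<close>, is \<open>f \<theta> t\<close>.
\<close>

definition positive_density :: "'p measure \<Rightarrow> ('p \<Rightarrow> real) \<Rightarrow> bool" where
  "positive_density \<nu> p \<longleftrightarrow>
     p \<in> borel_measurable \<nu> \<and> (\<forall>\<theta>\<in>space \<nu>. 0 < p \<theta>) \<and> (\<integral>\<^sup>+\<theta>. ennreal (p \<theta>) \<partial>\<nu>) = 1"

text \<open>
  Sufficiency: conditional probabilities given the statistic have a version that is the same for
  all parameter values.
\<close>

definition sufficient_statistic ::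
    "'x measure \<Rightarrow> 'p set \<Rightarrow> ('p \<Rightarrow> 'x measure) \<Rightarrow> 's measure \<Rightarrow> ('x \<Rightarrow> 's) \<Rightarrow> bool" where
  "sufficient_statistic X \<Theta> P Y S \<longleftrightarrow>
     S \<in> measurable X Y \<and>
     (\<forall>A\<in>sets X. \<exists>k\<in>borel_measurable Y. \<forall>\<theta>\<in>\<Theta>. AE x in P \<theta>.
        real_cond_exp (P \<theta>) (vimage_algebra (space X) S Y) (indicator A) x = k (S x))"

text \<open>
  A minimal sufficient statistic is almost surely a measurable function of every sufficient
  statistic. Only competitors \<open>S\<close> with values in the type of the sample space (with an arbitrary
  sigma-algebra \<open>Y\<close> there) are quantified over. This is no restriction: the image of an arbitrary
  statistic can be identified with a set of representatives of its fibres in the sample space, and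
  its trace sigma-algebra transported along this bijection.
\<close>

definition minimal_sufficient_statistic ::
    "'x measure \<Rightarrow> 'p set \<Rightarrow> ('p \<Rightarrow> 'x measure) \<Rightarrow> 't measure \<Rightarrow> ('x \<Rightarrow> 't) \<Rightarrow> bool" where
  "minimal_sufficient_statistic X \<Theta> P M T \<longleftrightarrow>
     sufficient_statistic X \<Theta> P M T \<and>
     (\<forall>(Y :: 'x measure) (S :: 'x \<Rightarrow> 'x). sufficient_statistic X \<Theta> P Y S \<longrightarrow>
        (\<exists>h\<in>measurable (restrict_space Y (S ` space X)) M.
           \<forall>\<theta>\<in>\<Theta>. AE x in P \<theta>. T x = h (S x)))"

definition prior_predictive ::
    "'p measure \<Rightarrow> ('p \<Rightarrow> 't \<Rightarrow> real) \<Rightarrow> ('p \<Rightarrow> real) \<Rightarrow> 't \<Rightarrow> ennreal" where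
  "prior_predictive \<nu> f p t = (\<integral>\<^sup>+\<theta>. ennreal (f \<theta> t * p \<theta>) \<partial>\<nu>)"

definition posterior_density ::
    "'p measure \<Rightarrow> ('p \<Rightarrow> 't \<Rightarrow> real) \<Rightarrow> ('p \<Rightarrow> real) \<Rightarrow> 't \<Rightarrow> 'p \<Rightarrow> real" where
  "posterior_density \<nu> f p t \<theta> = f \<theta> t * p \<theta> / enn2real (prior_predictive \<nu> f p t)"

definition prior_measure :: "'p measure \<Rightarrow> ('p \<Rightarrow> real) \<Rightarrow> 'p measure" where
  "prior_measure \<nu> p = density \<nu> (\<lambda>\<theta>. ennreal (p \<theta>))"

definition posterior_measure ::
    "'p measure \<Rightarrow> ('p \<Rightarrow> 't \<Rightarrow> real) \<Rightarrow> ('p \<Rightarrow> real) \<Rightarrow> 't \<Rightarrow> 'p measure" where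
  "posterior_measure \<nu> f p t = density \<nu> (\<lambda>\<theta>. ennreal (posterior_density \<nu> f p t \<theta>))"

definition contaminated_prior ::
    "'p measure \<Rightarrow> ('p \<Rightarrow> real) \<Rightarrow> ('p \<Rightarrow> real) \<Rightarrow> real \<Rightarrow> 'p \<Rightarrow> real" where
  "contaminated_prior \<nu> p q \<epsilon> \<theta> =
     p \<theta> powr (1 - \<epsilon>) * q \<theta> powr \<epsilon> / (\<integral>\<theta>'. p \<theta>' powr (1 - \<epsilon>) * q \<theta>' powr \<epsilon> \<partial>\<nu>)"

definition relative_belief_ratio ::
    "'p measure \<Rightarrow> ('p \<Rightarrow> 't \<Rightarrow> real) \<Rightarrow> ('p \<Rightarrow> real) \<Rightarrow> 'p \<Rightarrow> 't \<Rightarrow> real" where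
  "relative_belief_ratio \<nu> f p \<theta> t = f \<theta> t / enn2real (prior_predictive \<nu> f p t)"

end

theory Submission
  imports Defs
begin

text \<open>
  Bayes' rule gives \<open>m\<^sub>\<epsilon> = m E\<^sub>p\<^sub>o\<^sub>s\<^sub>t(r\<^sup>\<epsilon>) / E\<^sub>\<pi>(r\<^sup>\<epsilon>)\<close>, so \<open>ln RB\<^sub>\<epsilon>\<close> is \<open>ln E\<^sub>\<pi>(r\<^sup>\<epsilon>) - ln E\<^sub>p\<^sub>o\<^sub>s\<^sub>t(r\<^sup>\<epsilon>)\<close>
  up to a constant. Both expectations are 1 at \<open>\<epsilon> = 0\<close>; the mean value theorem bounds their difference
  quotients by \<open>g\<close>, so dominated convergence gives the derivatives. That the result has mean zero
  is Fubini: averaging posterior expectations over the prior predictive returns the prior expectation.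
\<close>

text \<open>By the mean value theorem the increment is \<epsilon> times a derivative at an interior
  point, where \<open>bound\<close> applies. The factor \<epsilon> is what matters: after division
  by \<epsilon> a dominating function free of \<epsilon> remains.\<close>

lemma abs_powr_minus_one_le:
  fixes r :: real
  assumes "0 < r" "0 \<le> \<epsilon>" and bound: "\<And>s. s \<in> {0..\<epsilon>} \<Longrightarrow> \<bar>r powr s * ln r\<bar> \<le> g"
  shows "\<bar>r powr \<epsilon> - 1\<bar> \<le> \<epsilon> * g"
proof (cases "\<epsilon> = 0")
  case True
  then show ?thesis using \<open>0 < r\<close> by simp
next
  case False
  then have "0 < \<epsilon>" using \<open>0 \<le> \<epsilon>\<close> by simp
  have "((\<lambda>s. r powr s) has_real_derivative r powr s * ln r) (at s)" for s
    using \<open>0 < r\<close> by (auto intro!: derivative_eq_intros)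
  then obtain z where z: "0 < z" "z < \<epsilon>" "r powr \<epsilon> - r powr 0 = (\<epsilon> - 0) * (r powr z * ln r)"
    using MVT2[OF \<open>0 < \<epsilon>\<close>, of "\<lambda>s. r powr s" "\<lambda>s. r powr s * ln r"] by blast
  then have "\<bar>r powr \<epsilon> - 1\<bar> = \<epsilon> * \<bar>r powr z * ln r\<bar>"
    using \<open>0 < r\<close> \<open>0 < \<epsilon>\<close> by (simp add: abs_mult)
  also have "\<dots> \<le> \<epsilon> * g"
    using z \<open>0 < \<epsilon>\<close> by (intro mult_left_mono bound) auto
  finally show ?thesis .
qed

context prob_space
begin

text \<open>Stated over an abstract probability space because it is applied twice, to the prior and
  to the posterior. The derivative is one-sided since \<open>bound\<close> controls only nonnegative
  exponents.\<close>

lemma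
  fixes r g :: "'a \<Rightarrow> real"
  assumes r [measurable]: "r \<in> borel_measurable M" and pos: "\<And>x. x \<in> space M \<Longrightarrow> 0 < r x"
    and "0 < \<epsilon>\<^sub>0" and g: "integrable M g"
    and bound: "\<And>\<epsilon> x. \<epsilon> \<in> {0..\<epsilon>\<^sub>0} \<Longrightarrow> x \<in> space M \<Longrightarrow> \<bar>r x powr \<epsilon> * ln (r x)\<bar> \<le> g x"
  shows integrable_powr_dominated: "\<And>\<epsilon>. \<epsilon> \<in> {0..\<epsilon>\<^sub>0} \<Longrightarrow> integrable M (\<lambda>x. r x powr \<epsilon>)"
    and integrable_ln_dominated: "integrable M (\<lambda>x. ln (r x))"
    and expectation_powr_pos: "\<And>\<epsilon>. \<epsilon> \<in> {0..\<epsilon>\<^sub>0} \<Longrightarrow> 0 < expectation (\<lambda>x. r x powr \<epsilon>)"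
    and has_derivative_expectation_powr:
      "((\<lambda>\<epsilon>. expectation (\<lambda>x. r x powr \<epsilon>)) has_real_derivative expectation (\<lambda>x. ln (r x)))
         (at 0 within {0..})"
proof -
  have diff: "\<bar>r x powr \<epsilon> - 1\<bar> \<le> \<epsilon> * g x" if "\<epsilon> \<in> {0..\<epsilon>\<^sub>0}" "x \<in> space M" for \<epsilon> x
    using that pos by (intro abs_powr_minus_one_le bound) auto
  show int: "integrable M (\<lambda>x. r x powr \<epsilon>)" if \<epsilon>: "\<epsilon> \<in> {0..\<epsilon>\<^sub>0}" for \<epsilon>
  proof -
    \<comment> \<open>\<open>diff\<close> dominates the power only after 1 is subtracted; the
      constant is restored afterwards, being integrable on a probability space.\<close>
    have "integrable M (\<lambda>x. r x powr \<epsilon> - 1)"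
    proof (rule Bochner_Integration.integrable_bound)
      show "integrable M (\<lambda>x. \<epsilon> * g x)" using g by simp
      show "AE x in M. norm (r x powr \<epsilon> - 1) \<le> norm (\<epsilon> * g x)"
        using diff[OF \<epsilon>] by (intro AE_I2) force
    qed simp
    then have "integrable M (\<lambda>x. (r x powr \<epsilon> - 1) + 1)"
      by (rule Bochner_Integration.integrable_add) simp
    then show ?thesis by simp
  qed
  show "integrable M (\<lambda>x. ln (r x))"
  proof (rule Bochner_Integration.integrable_bound[OF g])
    show "AE x in M. norm (ln (r x)) \<le> norm (g x)"
      \<comment> \<open>At exponent 0 the power is 1, so \<open>bound\<close> becomes a bound on the
        logarithm itself.\<close>
      using bound[of 0] pos \<open>0 < \<epsilon>\<^sub>0\<close> by (intro AE_I2) force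
  qed simp
  show "0 < expectation (\<lambda>x. r x powr \<epsilon>)" if \<epsilon>: "\<epsilon> \<in> {0..\<epsilon>\<^sub>0}" for \<epsilon>
    using pos by (intro expectation_greater[OF int[OF \<epsilon>]] AE_I2) force
  show "((\<lambda>\<epsilon>. expectation (\<lambda>x. r x powr \<epsilon>)) has_real_derivative expectation (\<lambda>x. ln (r x)))
         (at 0 within {0..})"
  proof -
    let ?F = "\<lambda>\<epsilon>. expectation (\<lambda>x. r x powr \<epsilon>)"
    \<comment> \<open>Positivity of \<open>r\<close> enters because \<open>0 powr 0\<close> is 0 in
      HOL.\<close>
    have "?F 0 = expectation (\<lambda>x. 1)"
      using pos by (intro Bochner_Integration.integral_cong) (auto simp: less_imp_neq[symmetric])
    then have F0: "?F 0 = 1" by (simp add: prob_space)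
    \<comment> \<open>The limit is taken within the interval on which \<open>g\<close> dominates,
      and along sequences, the form in which dominated convergence is available.\<close>
    have "((\<lambda>\<epsilon>. (?F \<epsilon> - ?F 0) / (\<epsilon> - 0)) \<longlongrightarrow> expectation (\<lambda>x. ln (r x))) (at 0 within {0..\<epsilon>\<^sub>0})"
      unfolding tendsto_at_iff_sequentially
    proof (intro allI impI)
      fix e :: "nat \<Rightarrow> real"
      assume e: "\<forall>i. e i \<in> {0..\<epsilon>\<^sub>0} - {0}" and lim: "e \<longlonglongrightarrow> 0"
      have "(\<lambda>i. expectation (\<lambda>x. (r x powr e i - 1) / e i)) \<longlonglongrightarrow> expectation (\<lambda>x. ln (r x))"
      proof (rule integral_dominated_convergence[where w = g])
        show "AE x in M. (\<lambda>i. (r x powr e i - 1) / e i) \<longlonglongrightarrow> ln (r x)"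
        proof (rule AE_I2)
          fix x assume "x \<in> space M"
          then have rx: "0 < r x" by (rule pos)
          have "((\<lambda>s. r x powr s) has_real_derivative r x powr 0 * ln (r x)) (at 0)"
            using rx by (auto intro!: derivative_eq_intros)
          \<comment> \<open>For fixed \<open>x\<close> the power is differentiable on both sides of
            0, so its difference quotient converges along any null sequence of nonzero terms, in
            particular along \<open>e\<close>.\<close>
          then have "(\<lambda>s. (r x powr s - 1) / s) \<midarrow>0\<rightarrow> ln (r x)"
            using rx by (simp add: has_field_derivative_iff)
          then show "(\<lambda>i. (r x powr e i - 1) / e i) \<longlonglongrightarrow> ln (r x)"
            using e lim by (auto simp: tendsto_at_iff_sequentially o_def)
        qed
        \<comment> \<open>Dividing \<open>diff\<close> by the positive number \<open>e i\<close>
          leaves a bound independent of \<open>i\<close>.\<close>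
        show "AE x in M. norm ((r x powr e i - 1) / e i) \<le> g x" for i
        proof (rule AE_I2)
          fix x assume x: "x \<in> space M"
          have "e i \<in> {0..\<epsilon>\<^sub>0}" "0 < e i" using e[rule_format, of i] by auto
          then show "norm ((r x powr e i - 1) / e i) \<le> g x"
            using diff[of "e i" x] x by (simp add: abs_divide field_simps)
        qed
      qed (use g in simp_all)
      moreover have "expectation (\<lambda>x. (r x powr e i - 1) / e i) = (?F (e i) - 1) / e i" for i
      proof -
        have "integrable M (\<lambda>x. r x powr e i)"
          using e by (intro int) auto
        then have "expectation (\<lambda>x. r x powr e i - 1) = ?F (e i) - 1"
          by (simp add: prob_space)
        then show ?thesis by simp
      qed
      ultimately show "((\<lambda>\<epsilon>. (?F \<epsilon> - ?F 0) / (\<epsilon> - 0)) \<circ> e) \<longlonglongrightarrow> expectation (\<lambda>x. ln (r x))"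
        unfolding F0 o_def diff_0_right by (simp only:)
    qed
    \<comment> \<open>Within \<open>{0..\<epsilon>\<^sub>0}\<close> and within \<open>{0..}\<close>
      the filter at 0 is the same, namely \<open>at_right 0\<close>.\<close>
    then show ?thesis
      using \<open>0 < \<epsilon>\<^sub>0\<close>
      by (simp add: has_field_derivative_iff at_within_Icc_at_right at_within_Ici_at_right)
  qed
qed

end

lemma positive_densityD:
  assumes "positive_density \<nu> p"
  shows "p \<in> borel_measurable \<nu>" "\<And>\<theta>. \<theta> \<in> space \<nu> \<Longrightarrow> 0 < p \<theta>"
    "(\<integral>\<^sup>+\<theta>. ennreal (p \<theta>) \<partial>\<nu>) = 1"
  using assms by (auto simp: positive_density_def)

lemma prob_space_prior_measure:
  assumes "positive_density \<nu> p"
  shows "prob_space (prior_measure \<nu> p)"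
  using positive_densityD[OF assms]
  by (auto simp: prior_measure_def emeasure_density intro!: prob_spaceI cong: nn_integral_cong)

lemma integral_prior_measure:
  fixes h :: "'p \<Rightarrow> real"
  assumes p: "positive_density \<nu> p" and h: "h \<in> borel_measurable \<nu>"
  shows "(\<integral>\<eta>. h \<eta> \<partial>prior_measure \<nu> p) = (\<integral>\<eta>. p \<eta> * h \<eta> \<partial>\<nu>)"
    and "integrable (prior_measure \<nu> p) h \<longleftrightarrow> integrable \<nu> (\<lambda>\<eta>. p \<eta> * h \<eta>)"
  using positive_densityD[OF p] h
  by (auto simp: prior_measure_def integral_density integrable_density less_imp_le)

context
  fixes \<nu> :: "'p measure" and f :: "'p \<Rightarrow> 't \<Rightarrow> real" and p :: "'p \<Rightarrow> real" and t :: 't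
  assumes p: "positive_density \<nu> p"
    and f_meas [measurable]: "(\<lambda>\<theta>. f \<theta> t) \<in> borel_measurable \<nu>"
    and f_nonneg: "\<And>\<theta>. \<theta> \<in> space \<nu> \<Longrightarrow> 0 \<le> f \<theta> t"
    and predictive: "0 < prior_predictive \<nu> f p t" "prior_predictive \<nu> f p t < \<infinity>"
begin

private abbreviation (input) "m \<equiv> enn2real (prior_predictive \<nu> f p t)"

private lemma p_meas [measurable]: "p \<in> borel_measurable \<nu>"
  by (rule positive_densityD[OF p])

private lemma posterior_meas [measurable]: "posterior_density \<nu> f p t \<in> borel_measurable \<nu>"
  unfolding posterior_density_def by measurable

private lemma m_pos: "0 < m"
  using predictive by (simp add: enn2real_positive_iff)

private lemma posterior_nonneg: "\<theta> \<in> space \<nu> \<Longrightarrow> 0 \<le> posterior_density \<nu> f p t \<theta>"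
  using f_nonneg positive_densityD(2)[OF p] by (simp add: posterior_density_def less_imp_le)

text \<open>The total mass is the prior predictive density divided by itself. In
  \<open>ennreal\<close> this quotient is 1 because the value lies strictly between 0 and
  infinity.\<close>

lemma prob_space_posterior_measure: "prob_space (posterior_measure \<nu> f p t)"
proof (rule prob_spaceI)
  have "emeasure (posterior_measure \<nu> f p t) (space (posterior_measure \<nu> f p t)) =
      (\<integral>\<^sup>+\<theta>. ennreal (posterior_density \<nu> f p t \<theta>) \<partial>\<nu>)"
    by (auto simp: posterior_measure_def emeasure_density intro!: nn_integral_cong)
  also have "\<dots> = (\<integral>\<^sup>+\<theta>. ennreal (f \<theta> t * p \<theta>) / ennreal m \<partial>\<nu>)"
    using m_pos f_nonneg positive_densityD(2)[OF p]
    by (intro nn_integral_cong) (simp add: posterior_density_def divide_ennreal less_imp_le)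
  also have "\<dots> = prior_predictive \<nu> f p t / ennreal m"
    by (simp add: nn_integral_divide prior_predictive_def)
  also have "\<dots> = 1"
    using predictive by (simp add: ennreal_divide_self)
  finally show "emeasure (posterior_measure \<nu> f p t) (space (posterior_measure \<nu> f p t)) = 1" .
qed

text \<open>Bayes' rule with the denominator cleared. Integrability of \<open>h\<close> is not at
  issue: the two integrands over \<nu> differ by the nonzero constant \<open>m\<close>, so if one
  integral takes the default value 0, so does the other.\<close>

lemma predictive_mult_integral_posterior:
  fixes h :: "'p \<Rightarrow> real"
  assumes [measurable]: "h \<in> borel_measurable \<nu>"
  shows "m * (\<integral>\<eta>. h \<eta> \<partial>posterior_measure \<nu> f p t) = (\<integral>\<eta>. f \<eta> t * p \<eta> * h \<eta> \<partial>\<nu>)"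
proof -
  have "(\<integral>\<eta>. h \<eta> \<partial>posterior_measure \<nu> f p t) = (\<integral>\<eta>. posterior_density \<nu> f p t \<eta> * h \<eta> \<partial>\<nu>)"
    using posterior_nonneg by (simp add: posterior_measure_def integral_density)
  also have "\<dots> = (\<integral>\<eta>. f \<eta> t * p \<eta> * h \<eta> \<partial>\<nu>) / m"
    by (simp add: posterior_density_def)
  finally show ?thesis using m_pos by simp
qed

end

text \<open>Positivity allows the powers to be split, so that the numerator is the prior density
  times a power of the ratio. The same identity under the integral turns the normalising constant
  into a prior expectation, for every real \<epsilon>.\<close>

lemma contaminated_prior_eq:
  assumes p: "positive_density \<nu> p" and q: "positive_density \<nu> q" and "\<theta> \<in> space \<nu>"
  shows "contaminated_prior \<nu> p q \<epsilon> \<theta> =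
     (q \<theta> / p \<theta>) powr \<epsilon> * p \<theta> / (\<integral>\<eta>. (q \<eta> / p \<eta>) powr \<epsilon> \<partial>prior_measure \<nu> p)"
proof -
  note [measurable] = positive_densityD(1)[OF p] positive_densityD(1)[OF q]
  have eq: "p \<eta> powr (1 - \<epsilon>) * q \<eta> powr \<epsilon> = p \<eta> * (q \<eta> / p \<eta>) powr \<epsilon>" if "\<eta> \<in> space \<nu>" for \<eta>
    using positive_densityD(2)[OF p that] positive_densityD(2)[OF q that]
    by (simp add: powr_diff powr_divide)
  have "(\<integral>\<eta>. p \<eta> powr (1 - \<epsilon>) * q \<eta> powr \<epsilon> \<partial>\<nu>) = (\<integral>\<eta>. (q \<eta> / p \<eta>) powr \<epsilon> \<partial>prior_measure \<nu> p)"
    by (simp add: integral_prior_measure(1)[OF p] eq cong: Bochner_Integration.integral_cong)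
  then show ?thesis
    by (simp only: contaminated_prior_def eq[OF \<open>\<theta> \<in> space \<nu>\<close>] mult.commute[of "p \<theta>"])
qed

text \<open>The contaminated prior is the original one reweighted by a power of the ratio.
  Integrating against the likelihood therefore gives the original predictive density times a
  posterior expectation, while the normalising constant stays in the denominator.\<close>

lemma predictive_contaminated_prior:
  assumes p: "positive_density \<nu> p" and q: "positive_density \<nu> q"
    and f [measurable]: "(\<lambda>\<theta>. f \<theta> t) \<in> borel_measurable \<nu>"
    and f_nonneg: "\<And>\<theta>. \<theta> \<in> space \<nu> \<Longrightarrow> 0 \<le> f \<theta> t"
    and predictive: "0 < prior_predictive \<nu> f p t" "prior_predictive \<nu> f p t < \<infinity>"
  shows "enn2real (prior_predictive \<nu> f (contaminated_prior \<nu> p q \<epsilon>) t) =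
     enn2real (prior_predictive \<nu> f p t) *
       (\<integral>\<eta>. (q \<eta> / p \<eta>) powr \<epsilon> \<partial>posterior_measure \<nu> f p t) /
       (\<integral>\<eta>. (q \<eta> / p \<eta>) powr \<epsilon> \<partial>prior_measure \<nu> p)"
proof -
  note [measurable] = positive_densityD(1)[OF p] positive_densityD(1)[OF q]
  let ?c = "contaminated_prior \<nu> p q \<epsilon>"
  have [measurable]: "?c \<in> borel_measurable \<nu>"
    unfolding contaminated_prior_def by measurable
  have "0 \<le> ?c \<eta>" for \<eta>
    unfolding contaminated_prior_def
    by (intro divide_nonneg_nonneg Bochner_Integration.integral_nonneg mult_nonneg_nonneg) auto
  \<comment> \<open>For a nonnegative integrand the two integrals agree even in the divergent case,
    where \<open>enn2real\<close> of infinity and the Bochner integral are both 0.\<close>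
  then have "enn2real (prior_predictive \<nu> f ?c t) = (\<integral>\<eta>. f \<eta> t * ?c \<eta> \<partial>\<nu>)"
    unfolding prior_predictive_def using f_nonneg
    by (intro integral_eq_nn_integral[symmetric] AE_I2) auto
  also have "\<dots> = (\<integral>\<eta>. f \<eta> t * p \<eta> * (q \<eta> / p \<eta>) powr \<epsilon> /
      (\<integral>\<eta>. (q \<eta> / p \<eta>) powr \<epsilon> \<partial>prior_measure \<nu> p) \<partial>\<nu>)"
    by (intro Bochner_Integration.integral_cong) (simp_all add: contaminated_prior_eq[OF p q] mult_ac)
  also have "\<dots> = (\<integral>\<eta>. f \<eta> t * p \<eta> * (q \<eta> / p \<eta>) powr \<epsilon> \<partial>\<nu>) /
      (\<integral>\<eta>. (q \<eta> / p \<eta>) powr \<epsilon> \<partial>prior_measure \<nu> p)"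
    by simp
  also have "(\<integral>\<eta>. f \<eta> t * p \<eta> * (q \<eta> / p \<eta>) powr \<epsilon> \<partial>\<nu>) =
      enn2real (prior_predictive \<nu> f p t) *
        (\<integral>\<eta>. (q \<eta> / p \<eta>) powr \<epsilon> \<partial>posterior_measure \<nu> f p t)"
    by (intro predictive_mult_integral_posterior[symmetric] p f f_nonneg predictive) measurable
  finally show ?thesis .
qed

text \<open>The logarithm separates the predictive density into a constant, a prior and a posterior
  expectation. Since both expectations equal 1 at 0, their logarithmic derivatives there are their
  derivatives.\<close>

lemma has_derivative_ln_relative_belief_ratio:
  assumes p: "positive_density \<nu> p" and q: "positive_density \<nu> q"
    and f: "(\<lambda>\<theta>. f \<theta> t) \<in> borel_measurable \<nu>"
    and f_nonneg: "\<And>\<theta>. \<theta> \<in> space \<nu> \<Longrightarrow> 0 \<le> f \<theta> t"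
    and predictive: "0 < prior_predictive \<nu> f p t" "prior_predictive \<nu> f p t < \<infinity>"
    and "0 < \<epsilon>\<^sub>0"
    and bound: "\<And>\<epsilon> \<eta>. \<epsilon> \<in> {0..\<epsilon>\<^sub>0} \<Longrightarrow> \<eta> \<in> space \<nu> \<Longrightarrow>
      \<bar>(q \<eta> / p \<eta>) powr \<epsilon> * ln (q \<eta> / p \<eta>)\<bar> \<le> g \<eta>"
    and g_prior: "integrable (prior_measure \<nu> p) g"
    and g_posterior: "integrable (posterior_measure \<nu> f p t) g"
    and f_pos: "0 < f \<theta> t"
  shows "((\<lambda>\<epsilon>. ln (relative_belief_ratio \<nu> f (contaminated_prior \<nu> p q \<epsilon>) \<theta> t))
    has_real_derivative
      (\<integral>\<eta>. ln (q \<eta> / p \<eta>) \<partial>prior_measure \<nu> p)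
        - (\<integral>\<eta>. ln (q \<eta> / p \<eta>) \<partial>posterior_measure \<nu> f p t))
    (at 0 within {0..})"
proof -
  note [measurable] = positive_densityD(1)[OF p] positive_densityD(1)[OF q]
  have r: "0 < q \<eta> / p \<eta>" if "\<eta> \<in> space \<nu>" for \<eta>
    using positive_densityD(2)[OF p that] positive_densityD(2)[OF q that] by simp
  let ?m = "enn2real (prior_predictive \<nu> f p t)"
  let ?A = "\<lambda>\<epsilon>. \<integral>\<eta>. (q \<eta> / p \<eta>) powr \<epsilon> \<partial>prior_measure \<nu> p"
  let ?B = "\<lambda>\<epsilon>. \<integral>\<eta>. (q \<eta> / p \<eta>) powr \<epsilon> \<partial>posterior_measure \<nu> f p t"
  interpret prior: prob_space "prior_measure \<nu> p"
    by (rule prob_space_prior_measure[OF p])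
  interpret post: prob_space "posterior_measure \<nu> f p t"
    by (rule prob_space_posterior_measure[OF p f f_nonneg predictive])
  have A: "0 < ?A \<epsilon>" "(?A has_real_derivative (\<integral>\<eta>. ln (q \<eta> / p \<eta>) \<partial>prior_measure \<nu> p)) (at 0 within {0..})"
    if "\<epsilon> \<in> {0..\<epsilon>\<^sub>0}" for \<epsilon>
    using that r bound \<open>0 < \<epsilon>\<^sub>0\<close> g_prior
    by (intro prior.expectation_powr_pos[where g = g] prior.has_derivative_expectation_powr[where g = g];
        auto simp: prior_measure_def)+
  have B: "0 < ?B \<epsilon>"
      "(?B has_real_derivative (\<integral>\<eta>. ln (q \<eta> / p \<eta>) \<partial>posterior_measure \<nu> f p t)) (at 0 within {0..})"
    if "\<epsilon> \<in> {0..\<epsilon>\<^sub>0}" for \<epsilon>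
    using that r bound \<open>0 < \<epsilon>\<^sub>0\<close> g_posterior
    by (intro post.expectation_powr_pos[where g = g] post.has_derivative_expectation_powr[where g = g];
        auto simp: posterior_measure_def)+
  have one: "?A 0 = 1" "?B 0 = 1"
  proof -
    have "?A 0 = (\<integral>\<eta>. 1 \<partial>prior_measure \<nu> p)"
      using r by (intro Bochner_Integration.integral_cong) (force simp: prior_measure_def)+
    then show "?A 0 = 1" by (simp add: prior.prob_space)
    have "?B 0 = (\<integral>\<eta>. 1 \<partial>posterior_measure \<nu> f p t)"
      using r by (intro Bochner_Integration.integral_cong) (force simp: posterior_measure_def)+
    then show "?B 0 = 1" by (simp add: post.prob_space)
  qed
  have m: "0 < ?m" using predictive by (simp add: enn2real_positive_iff)
  have "((\<lambda>\<epsilon>. ln (f \<theta> t) - ln ?m + ln (?A \<epsilon>) - ln (?B \<epsilon>)) has_real_derivative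
      (\<integral>\<eta>. ln (q \<eta> / p \<eta>) \<partial>prior_measure \<nu> p)
        - (\<integral>\<eta>. ln (q \<eta> / p \<eta>) \<partial>posterior_measure \<nu> f p t)) (at 0 within {0..})"
    \<comment> \<open>The derivative statements do not depend on \<epsilon>, so any admissible value
      serves as instance. Deleting \<open>powr_zero_eq_one\<close> keeps \<open>?A 0\<close> and
      \<open>?B 0\<close> in the shape that \<open>one\<close> rewrites.\<close>
    using A(2)[of 0] B(2)[of 0] \<open>0 < \<epsilon>\<^sub>0\<close>
    by (auto intro!: derivative_eq_intros simp: one simp del: powr_zero_eq_one)
  then show ?thesis
  \<comment> \<open>The logarithm splits only where both expectations are known to be positive,
    hence the radius \<open>\<epsilon>\<^sub>0\<close>.\<close>
  proof (rule has_field_derivative_transform_within)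
    fix \<epsilon> :: real assume "\<epsilon> \<in> {0..}" "dist \<epsilon> 0 < \<epsilon>\<^sub>0"
    then have "\<epsilon> \<in> {0..\<epsilon>\<^sub>0}" by simp
    then have "0 < ?A \<epsilon>" "0 < ?B \<epsilon>" by (rule A B)+
    then show "ln (f \<theta> t) - ln ?m + ln (?A \<epsilon>) - ln (?B \<epsilon>) =
        ln (relative_belief_ratio \<nu> f (contaminated_prior \<nu> p q \<epsilon>) \<theta> t)"
      using f_pos m
      by (simp add: relative_belief_ratio_def predictive_contaminated_prior[OF p q f f_nonneg predictive]
          ln_div ln_mult)
  qed (use \<open>0 < \<epsilon>\<^sub>0\<close> in simp_all)
qed

text \<open>Integrating over \<open>t\<close> first, each sampling density has mass 1 and only
  \<open>h\<close> remains. It is used with \<open>h\<close> the prior density and with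
  \<open>h\<close> the prior density times the log ratio.\<close>

lemma has_bochner_integral_mixture:
  fixes f :: "'p \<Rightarrow> 't \<Rightarrow> real" and h :: "'p \<Rightarrow> real"
  assumes "sigma_finite_measure \<nu>" and "sigma_finite_measure \<mu>"
    and f [measurable]: "(\<lambda>(\<theta>, t). f \<theta> t) \<in> borel_measurable (\<nu> \<Otimes>\<^sub>M \<mu>)"
    and f_nonneg: "\<And>\<theta> t. \<theta> \<in> space \<nu> \<Longrightarrow> t \<in> space \<mu> \<Longrightarrow> 0 \<le> f \<theta> t"
    and f_one: "\<And>\<theta>. \<theta> \<in> space \<nu> \<Longrightarrow> (\<integral>\<^sup>+t. ennreal (f \<theta> t) \<partial>\<mu>) = 1"
    and h: "integrable \<nu> h"
  shows "has_bochner_integral \<mu> (\<lambda>t. \<integral>\<theta>. f \<theta> t * h \<theta> \<partial>\<nu>) (\<integral>\<theta>. h \<theta> \<partial>\<nu>)"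
proof -
  interpret \<nu>: sigma_finite_measure \<nu> by fact
  interpret \<mu>: sigma_finite_measure \<mu> by fact
  interpret pair_sigma_finite \<nu> \<mu> ..
  have [measurable]: "h \<in> borel_measurable \<nu>" using h by simp
  have f\<theta>: "has_bochner_integral \<mu> (f \<theta>) 1" if "\<theta> \<in> space \<nu>" for \<theta>
    using that f_one[OF that] f_nonneg
    by (intro has_bochner_integral_nn_integral AE_I2) auto
  have int: "integrable (\<nu> \<Otimes>\<^sub>M \<mu>) (\<lambda>(\<theta>, t). f \<theta> t * h \<theta>)"
  proof (rule Fubini_integrable)
    \<comment> \<open>Absolute integrability on the product space: the inner integral of the norm
      collapses to \<open>norm (h \<theta>)\<close>, as \<open>f \<theta>\<close> is nonnegative
      with mass 1.\<close>
    have "(\<integral>t. norm (f \<theta> t * h \<theta>) \<partial>\<mu>) = norm (h \<theta>)" if "\<theta> \<in> space \<nu>" for \<theta>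
    proof -
      have "(\<integral>t. norm (f \<theta> t * h \<theta>) \<partial>\<mu>) = (\<integral>t. f \<theta> t * norm (h \<theta>) \<partial>\<mu>)"
        using f_nonneg that by (intro Bochner_Integration.integral_cong) (auto simp: abs_mult)
      then show ?thesis
        using f\<theta>[OF that] by (simp add: has_bochner_integral_iff)
    qed
    then show "integrable \<nu> (\<lambda>\<theta>. \<integral>t. norm (case (\<theta>, t) of (\<theta>, t) \<Rightarrow> f \<theta> t * h \<theta>) \<partial>\<mu>)"
      using integrable_norm[OF h] by (simp cong: Bochner_Integration.integrable_cong)
    show "AE \<theta> in \<nu>. integrable \<mu> (\<lambda>t. case (\<theta>, t) of (\<theta>, t) \<Rightarrow> f \<theta> t * h \<theta>)"
      using f\<theta> by (intro AE_I2) (auto simp: has_bochner_integral_iff)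
  qed measurable
  have "(\<integral>t. \<integral>\<theta>. f \<theta> t * h \<theta> \<partial>\<nu> \<partial>\<mu>) = (\<integral>\<theta>. \<integral>t. f \<theta> t * h \<theta> \<partial>\<mu> \<partial>\<nu>)"
    using Fubini_integral[OF int] by simp
  also have "\<dots> = (\<integral>\<theta>. h \<theta> \<partial>\<nu>)"
    using f\<theta> by (intro Bochner_Integration.integral_cong) (auto simp: has_bochner_integral_iff)
  finally show ?thesis
    using integrable_snd[OF int] by (simp add: has_bochner_integral_iff)
qed

text \<open>The mean-zero claim is a \<open>has_bochner_integral\<close> statement because an
  integral equal to 0 could also come from a non-integrable function. There
  \<open>vector_derivative\<close> names the derivative as a function of \<open>t\<close>.\<close>

theorem proposition8:
  fixes X :: "'x measure" and P :: "'p \<Rightarrow> 'x measure"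
    and \<nu> :: "'p measure" and \<mu> :: "'t measure" and T :: "'x \<Rightarrow> 't"
    and f :: "'p \<Rightarrow> 't \<Rightarrow> real" and \<pi> q r g :: "'p \<Rightarrow> real" and \<epsilon>\<^sub>0 :: real and \<theta> :: 'p
  assumes "sigma_finite_measure \<nu>" and "sigma_finite_measure \<mu>"
    and model: "\<And>\<theta>. \<theta> \<in> space \<nu> \<Longrightarrow> prob_space (P \<theta>)" "\<And>\<theta>. \<theta> \<in> space \<nu> \<Longrightarrow> sets (P \<theta>) = sets X"
    and minimal: "minimal_sufficient_statistic X (space \<nu>) P \<mu> T"
    and f_measurable: "(\<lambda>(\<theta>, t). f \<theta> t) \<in> borel_measurable (\<nu> \<Otimes>\<^sub>M \<mu>)"
    and f_nonneg: "\<And>\<theta> t. \<theta> \<in> space \<nu> \<Longrightarrow> t \<in> space \<mu> \<Longrightarrow> 0 \<le> f \<theta> t"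
    and f_density: "\<And>\<theta>. \<theta> \<in> space \<nu> \<Longrightarrow> distr (P \<theta>) \<mu> T = density \<mu> (\<lambda>t. ennreal (f \<theta> t))"
    and \<pi>: "positive_density \<nu> \<pi>" and q: "positive_density \<nu> q"
    and r: "\<And>\<theta>. r \<theta> = q \<theta> / \<pi> \<theta>"
    and "0 < \<epsilon>\<^sub>0"
    and normalizable: "\<And>\<epsilon>. \<epsilon> \<in> {0..\<epsilon>\<^sub>0} \<Longrightarrow> integrable \<nu> (\<lambda>\<theta>. \<pi> \<theta> powr (1 - \<epsilon>) * q \<theta> powr \<epsilon>)"
    and g_nonneg: "\<And>\<theta>. \<theta> \<in> space \<nu> \<Longrightarrow> 0 \<le> g \<theta>"
    and g_bound: "\<And>\<epsilon> \<theta>. \<epsilon> \<in> {0..\<epsilon>\<^sub>0} \<Longrightarrow> \<theta> \<in> space \<nu> \<Longrightarrow> \<bar>r \<theta> powr \<epsilon> * ln (r \<theta>)\<bar> \<le> g \<theta>"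
    and g_prior: "integrable (prior_measure \<nu> \<pi>) g"
    and g_posterior: "\<And>t. t \<in> space \<mu> \<Longrightarrow> integrable (posterior_measure \<nu> f \<pi> t) g"
    and \<theta>: "\<theta> \<in> space \<nu>" "\<And>t. t \<in> space \<mu> \<Longrightarrow> 0 < f \<theta> t"
    and predictive: "\<And>t. t \<in> space \<mu> \<Longrightarrow> 0 < prior_predictive \<nu> f \<pi> t \<and> prior_predictive \<nu> f \<pi> t < \<infinity>"
  shows "(\<forall>\<epsilon>\<in>{0..\<epsilon>\<^sub>0}. \<forall>\<theta>'\<in>space \<nu>. contaminated_prior \<nu> \<pi> q \<epsilon> \<theta>' =
            r \<theta>' powr \<epsilon> * \<pi> \<theta>' / (\<integral>\<eta>. r \<eta> powr \<epsilon> \<partial>prior_measure \<nu> \<pi>)) \<and>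
         integrable (prior_measure \<nu> \<pi>) (\<lambda>\<eta>. ln (r \<eta>)) \<and>
         (\<forall>x\<in>space X. integrable (posterior_measure \<nu> f \<pi> (T x)) (\<lambda>\<eta>. ln (r \<eta>)) \<and>
            ((\<lambda>\<epsilon>. ln (relative_belief_ratio \<nu> f (contaminated_prior \<nu> \<pi> q \<epsilon>) \<theta> (T x)))
               has_real_derivative
                 (\<integral>\<eta>. ln (r \<eta>) \<partial>prior_measure \<nu> \<pi>)
                   - (\<integral>\<eta>. ln (r \<eta>) \<partial>posterior_measure \<nu> f \<pi> (T x)))
              (at 0 within {0..})) \<and>
         has_bochner_integral (density \<mu> (prior_predictive \<nu> f \<pi>))
           (\<lambda>t. vector_derivative
                  (\<lambda>\<epsilon>. ln (relative_belief_ratio \<nu> f (contaminated_prior \<nu> \<pi> q \<epsilon>) \<theta> t))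
                  (at 0 within {0..}))
           0"
proof -
  let ?prior = "prior_measure \<nu> \<pi>" and ?post = "posterior_measure \<nu> f \<pi>"
    and ?m = "\<lambda>t. enn2real (prior_predictive \<nu> f \<pi> t)"
    and ?RB = "\<lambda>t \<epsilon>. ln (relative_belief_ratio \<nu> f (contaminated_prior \<nu> \<pi> q \<epsilon>) \<theta> t)"
  have r_def: "r = (\<lambda>\<eta>. q \<eta> / \<pi> \<eta>)" using r by blast
  note [measurable] = f_measurable positive_densityD(1)[OF \<pi>] positive_densityD(1)[OF q]
  have r_meas [measurable]: "r \<in> borel_measurable \<nu>" unfolding r_def by measurable
  have r_pos: "0 < r \<eta>" if "\<eta> \<in> space \<nu>" for \<eta>
    using positive_densityD(2)[OF \<pi> that] positive_densityD(2)[OF q that] r by simp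
  \<comment> \<open>Sufficiency includes measurability, which places \<open>T x\<close> in
    \<open>space \<mu>\<close> for every sample point.\<close>
  have T [measurable]: "T \<in> measurable X \<mu>"
    using minimal by (simp add: minimal_sufficient_statistic_def sufficient_statistic_def)
  have f_t [measurable]: "(\<lambda>\<eta>. f \<eta> t) \<in> borel_measurable \<nu>" if [measurable]: "t \<in> space \<mu>" for t
    by measurable
  interpret prior: prob_space ?prior
    by (rule prob_space_prior_measure[OF \<pi>])
  have post: "prob_space (?post t)" if "t \<in> space \<mu>" for t
    using that predictive[OF that] f_nonneg by (intro prob_space_posterior_measure \<pi> f_t) auto

  have contaminated: "\<forall>\<epsilon>\<in>{0..\<epsilon>\<^sub>0}. \<forall>\<theta>'\<in>space \<nu>. contaminated_prior \<nu> \<pi> q \<epsilon> \<theta>' =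
      r \<theta>' powr \<epsilon> * \<pi> \<theta>' / (\<integral>\<eta>. r \<eta> powr \<epsilon> \<partial>?prior)"
    unfolding r_def using contaminated_prior_eq[OF \<pi> q] by blast
  have ln_prior: "integrable ?prior (\<lambda>\<eta>. ln (r \<eta>))"
    using r_pos g_bound \<open>0 < \<epsilon>\<^sub>0\<close> g_prior
    by (intro prior.integrable_ln_dominated[where g = g and \<epsilon>\<^sub>0 = \<epsilon>\<^sub>0]) (auto simp: prior_measure_def)
  have ln_post: "integrable (?post t) (\<lambda>\<eta>. ln (r \<eta>))" if t: "t \<in> space \<mu>" for t
    using r_pos g_bound \<open>0 < \<epsilon>\<^sub>0\<close> g_posterior[OF t]
    by (intro prob_space.integrable_ln_dominated[OF post[OF t], where g = g and \<epsilon>\<^sub>0 = \<epsilon>\<^sub>0])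
      (auto simp: posterior_measure_def)
  have deriv: "(?RB t has_real_derivative
      (\<integral>\<eta>. ln (r \<eta>) \<partial>?prior) - (\<integral>\<eta>. ln (r \<eta>) \<partial>?post t)) (at 0 within {0..})"
    if t: "t \<in> space \<mu>" for t
    unfolding r_def using t predictive[OF t] f_nonneg \<theta> g_bound
    by (intro has_derivative_ln_relative_belief_ratio[OF \<pi> q f_t _ _ _ \<open>0 < \<epsilon>\<^sub>0\<close> _ g_prior g_posterior])
      (auto simp: r_def)
  have vd: "vector_derivative (?RB t) (at 0 within {0..}) =
      (\<integral>\<eta>. ln (r \<eta>) \<partial>?prior) - (\<integral>\<eta>. ln (r \<eta>) \<partial>?post t)" if "t \<in> space \<mu>" for t
    using deriv[OF that]
    \<comment> \<open>The choice made by \<open>vector_derivative\<close> is determined because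
      \<open>at_right 0\<close> is a nontrivial filter.\<close>
    by (intro vector_derivative_within)
      (simp_all add: at_within_Ici_at_right has_real_derivative_iff_has_vector_derivative)

  \<comment> \<open>\<open>f \<eta>\<close> is the density of the law of \<open>T\<close> under
    \<open>P \<eta>\<close>, a probability measure.\<close>
  have f_one: "(\<integral>\<^sup>+t. ennreal (f \<eta> t) \<partial>\<mu>) = 1" if \<eta>: "\<eta> \<in> space \<nu>" for \<eta>
  proof -
    interpret P: prob_space "P \<eta>" by (rule model(1)[OF \<eta>])
    have [measurable]: "f \<eta> \<in> borel_measurable \<mu>" using \<eta> by measurable
    have "T \<in> measurable (P \<eta>) \<mu>"
      using T measurable_cong_sets[OF model(2)[OF \<eta>] refl, of \<mu>] by blast
    then have "prob_space (density \<mu> (\<lambda>t. ennreal (f \<eta> t)))"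
      using P.prob_space_distr f_density[OF \<eta>] by metis
    from prob_space.emeasure_space_1[OF this] show ?thesis
      by (simp add: emeasure_density cong: nn_integral_cong)
  qed
  note mixture = has_bochner_integral_mixture[OF assms(1,2) f_measurable f_nonneg f_one]
  have [measurable]: "prior_predictive \<nu> f \<pi> \<in> borel_measurable \<mu>"
  proof -
    interpret sigma_finite_measure \<nu> by fact
    show ?thesis unfolding prior_predictive_def by measurable
  qed
  have mult_post: "?m t * (\<integral>\<eta>. h \<eta> \<partial>?post t) = (\<integral>\<eta>. f \<eta> t * (\<pi> \<eta> * h \<eta>) \<partial>\<nu>)"
    if t: "t \<in> space \<mu>" and "h \<in> borel_measurable \<nu>" for t and h :: "'p \<Rightarrow> real"
    using predictive_mult_integral_posterior[where t = t and f = f, OF \<pi> f_t[OF t] f_nonneg[OF _ t]]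
      predictive[OF t] that(2)
    by (simp add: mult.assoc)
  have m_total: "has_bochner_integral \<mu> ?m 1"
  proof -
    have "has_bochner_integral \<nu> \<pi> 1"
      using positive_densityD[OF \<pi>]
      by (intro has_bochner_integral_nn_integral AE_I2) (auto simp: less_imp_le)
    then have "has_bochner_integral \<mu> (\<lambda>t. \<integral>\<eta>. f \<eta> t * \<pi> \<eta> \<partial>\<nu>) 1"
      using mixture[of \<pi>] by (simp add: has_bochner_integral_iff)
    \<comment> \<open>The case \<open>h = 1\<close> of \<open>mult_post\<close>, as the posterior
      has total mass 1.\<close>
    moreover have "?m t = (\<integral>\<eta>. f \<eta> t * \<pi> \<eta> \<partial>\<nu>)" if t: "t \<in> space \<mu>" for t
      using mult_post[OF t, of "\<lambda>_. 1"] prob_space.prob_space[OF post[OF t]] by simp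
    ultimately show ?thesis by (simp cong: has_bochner_integral_cong)
  qed
  have ln_total: "has_bochner_integral \<mu> (\<lambda>t. ?m t * (\<integral>\<eta>. ln (r \<eta>) \<partial>?post t))
      (\<integral>\<eta>. ln (r \<eta>) \<partial>?prior)"
    using mixture[of "\<lambda>\<eta>. \<pi> \<eta> * ln (r \<eta>)"] ln_prior
    by (simp add: mult_post integral_prior_measure[OF \<pi>] cong: has_bochner_integral_cong)
  \<comment> \<open>The constant prior expectation, weighted by a density of mass 1, integrates to
    itself and cancels against \<open>ln_total\<close>.\<close>
  have "has_bochner_integral \<mu>
      (\<lambda>t. ?m t *\<^sub>R ((\<integral>\<eta>. ln (r \<eta>) \<partial>?prior) - (\<integral>\<eta>. ln (r \<eta>) \<partial>?post t))) 0"
    using has_bochner_integral_diff[OF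
        has_bochner_integral_mult_left[OF m_total, of "\<integral>\<eta>. ln (r \<eta>) \<partial>?prior"] ln_total]
    by (simp add: right_diff_distrib)
  \<comment> \<open>Measurability in \<open>t\<close> is known for the product with
    \<open>?m t\<close>, by Fubini; dividing by the positive \<open>?m t\<close> transfers it to the
    posterior expectation.\<close>
  moreover have "(\<lambda>t. \<integral>\<eta>. ln (r \<eta>) \<partial>?post t) \<in> borel_measurable \<mu>"
  proof -
    have "(\<lambda>t. ?m t * (\<integral>\<eta>. ln (r \<eta>) \<partial>?post t) / ?m t) \<in> borel_measurable \<mu>"
      using borel_measurable_has_bochner_integral[OF ln_total] by measurable
    moreover have "?m t * (\<integral>\<eta>. ln (r \<eta>) \<partial>?post t) / ?m t = (\<integral>\<eta>. ln (r \<eta>) \<partial>?post t)"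
      if "t \<in> space \<mu>" for t
      using predictive[OF that] by (auto simp: enn2real_eq_0_iff)
    ultimately show ?thesis
      by (subst measurable_cong) (auto simp only:)
  qed
  ultimately have "has_bochner_integral (density \<mu> (\<lambda>t. ennreal (?m t)))
      (\<lambda>t. (\<integral>\<eta>. ln (r \<eta>) \<partial>?prior) - (\<integral>\<eta>. ln (r \<eta>) \<partial>?post t)) 0"
    by (intro has_bochner_integral_density) auto
  then have "has_bochner_integral (density \<mu> (\<lambda>t. ennreal (?m t)))
      (\<lambda>t. vector_derivative (?RB t) (at 0 within {0..})) 0"
    by (rule iffD1[OF has_bochner_integral_cong, rotated 3]) (simp_all add: vd)
  \<comment> \<open>Finiteness of the predictive density makes the passage through
    \<open>enn2real\<close> lossless.\<close>
  moreover have "density \<mu> (\<lambda>t. ennreal (?m t)) = density \<mu> (prior_predictive \<nu> f \<pi>)"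
    using predictive by (intro density_cong AE_I2) (simp_all add: less_top)
  ultimately show ?thesis
    using contaminated ln_prior
    by (intro conjI ballI ln_post deriv measurable_space[OF T]) (simp_all only:)
qed

end
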